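(* Let $n\ge 1$. Assume that the log-Brunn-Minkowski inequality holds in dimension $n$ for the Lebesgue measure, i.e. for all symmetric convex bodies $K,L$ in $\mathbb{R}^n$ and all $\lambda\in(0,1)$, $$|\lambda\cdot K+_0(1-\lambda)\cdot L|\ \geq\ |K|^{\lambda}|L|^{1-\lambda}.$$ Then the B-conjecture holds in dimension $n$ for every even log-concave density, i.e. for every measure $\mu$ on $\mathbb{R}^n$ with an even log-concave density and every symmetric convex body $K$ in $\mathbb{R}^n$, the function $\mathbb{R}\ni t\mapsto\mu(e^tK)$ is log-concave.
   Context: A convex body in $\mathbb{R}^n$ is a compact convex set with non-empty interior; it is symmetric if $K=-K$. $|\cdot|$ is $n$-dimensional Lebesgue measure. The support function of $K$ is $h_K(u)=\max_{y\in K}u\cdot y$. For convex bodies $K,L$ containing the origin in their interiors and $\lambda\in(0,1)$, the logarithmic sum is $$\lambda\cdot K+_0(1-\lambda)\cdot L=\{x\in\mathbb{R}^n : x\cdot u\le h_K(u)^{\lambda}h_L(u)^{1-\lambda}\ \text{for all } u\in S^{n-1}\}.$$ A non-negative function is log-concave if its logarithm (with values in $[-\infty,\infty)$) is concave; a function $f$ on $\mathbb{R}^n$ is even if $f(-x)=f(x)$. *)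

theory Defs
  imports "HOL-Analysis.Analysis"
begin

definition convex_body :: "'a::euclidean_space set \<Rightarrow> bool" where
  "convex_body K \<longleftrightarrow> compact K \<and> convex K \<and> interior K \<noteq> {}"

definition symmetric_convex_body :: "'a::euclidean_space set \<Rightarrow> bool" where
  "symmetric_convex_body K \<longleftrightarrow> convex_body K \<and> K = uminus ` K"

text \<open>On a convex body the supremum is a maximum, by compactness.\<close>

definition support_fun :: "'a::euclidean_space set \<Rightarrow> 'a \<Rightarrow> real" where
  "support_fun K u = (SUP y\<in>K. u \<bullet> y)"

definition log_sum :: "real \<Rightarrow> 'a::euclidean_space set \<Rightarrow> 'a set \<Rightarrow> 'a set" where
  "log_sum s K L =
     {x. \<forall>u\<in>sphere 0 1. x \<bullet> u \<le> support_fun K u powr s * support_fun L u powr (1 - s)}"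

text \<open>The logarithm of a non-negative real, with values in \<open>[-\<infinity>, \<infinity>)\<close>.
  The function \<open>ln\<close> on the reals does not serve here, since \<open>ln 0 = 0\<close>.\<close>

definition ext_ln :: "real \<Rightarrow> ereal" where
  "ext_ln x = (if x = 0 then -\<infinity> else ereal (ln x))"

text \<open>The weights are strictly between 0 and 1, so \<open>0 * -\<infinity>\<close> never occurs.\<close>

definition log_concave_fun :: "('a::real_vector \<Rightarrow> real) \<Rightarrow> bool" where
  "log_concave_fun f \<longleftrightarrow> (\<forall>x. 0 \<le> f x) \<and>
     (\<forall>x y. \<forall>s\<in>{0<..<1}.
        ereal s * ext_ln (f x) + ereal (1 - s) * ext_ln (f y)
          \<le> ext_ln (f (s *\<^sub>R x + (1 - s) *\<^sub>R y)))"

definition has_even_log_concave_density :: "'a::euclidean_space measure \<Rightarrow> bool" where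
  "has_even_log_concave_density \<mu> \<longleftrightarrow>
     (\<exists>f. f \<in> borel_measurable lebesgue \<and> log_concave_fun f \<and> (\<forall>x. f (- x) = f x) \<and>
          \<mu> = density lebesgue (\<lambda>x. ennreal (f x)))"

text \<open>An even log-concave function is bounded by its value at 0. Hence such a measure need not be
  finite, but it is finite on bounded sets, and there the real-valued \<open>measure\<close> loses nothing.\<close>

lemma even_log_concave_le_zero:
  fixes f :: "'a::real_vector \<Rightarrow> real"
  assumes f: "log_concave_fun f" and ev: "\<And>x. f (- x) = f x"
  shows "f x \<le> f 0"
proof (cases "f x = 0")
  case True
  then show ?thesis using f by (simp add: log_concave_fun_def)
next
  case False
  have nn: "0 \<le> f y" for y using f by (simp add: log_concave_fun_def)
  have "ereal s * ext_ln (f y) + ereal (1 - s) * ext_ln (f z)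
      \<le> ext_ln (f (s *\<^sub>R y + (1 - s) *\<^sub>R z))" if "s \<in> {0<..<1}" for y z s
    using f that unfolding log_concave_fun_def by blast
  from this[of "1/2" x "- x"]
  have "ereal (1/2) * ext_ln (f x) + ereal (1/2) * ext_ln (f x) \<le> ext_ln (f 0)"
    by (simp add: ev)
  then have le: "ereal (ln (f x)) \<le> ext_ln (f 0)"
    using False by (simp add: ext_ln_def split: if_splits)
  then have "f 0 \<noteq> 0" by (auto simp: ext_ln_def)
  with le have "ln (f x) \<le> ln (f 0)" by (simp add: ext_ln_def)
  then show ?thesis using False \<open>f 0 \<noteq> 0\<close> nn[of x] nn[of 0] by simp
qed

lemma emeasure_even_log_concave_density_finite:
  fixes \<mu> :: "'a::euclidean_space measure"
  assumes "has_even_log_concave_density \<mu>" and "compact A"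
  shows "emeasure \<mu> A < \<infinity>"
proof -
  obtain f where f: "f \<in> borel_measurable lebesgue" "log_concave_fun f" "\<And>x. f (- x) = f x"
    and \<mu>: "\<mu> = density lebesgue (\<lambda>x. ennreal (f x))"
    using assms(1) unfolding has_even_log_concave_density_def by blast
  have A: "A \<in> lmeasurable" using assms(2) by (rule lmeasurable_compact)
  then have As: "A \<in> sets lebesgue" by (rule fmeasurableD)
  have "emeasure \<mu> A = (\<integral>\<^sup>+x. ennreal (f x) * indicator A x \<partial>lebesgue)"
    unfolding \<mu> using f(1) As by (intro emeasure_density) auto
  also have "\<dots> \<le> (\<integral>\<^sup>+x. ennreal (f 0) * indicator A x \<partial>lebesgue)"
    using even_log_concave_le_zero[OF f(2,3)]
    by (intro nn_integral_mono mult_right_mono ennreal_leI) auto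
  also have "\<dots> = ennreal (f 0) * emeasure lebesgue A"
    using As by (rule nn_integral_cmult_indicator)
  also have "\<dots> < \<infinity>"
    using fmeasurableD2[OF A] by (simp add: ennreal_mult_less_top less_top)
  finally show ?thesis .
qed

end

theory Submission
  imports Defs
begin

text \<open>Let \<open>f\<close> be the density and let \<open>N t x\<close> be the volume of \<open>e\<^sup>tK \<inter> {f > e\<^sup>x}\<close>.
  The logarithmic sum of two such sets, with parameters \<open>(t, x)\<close> and \<open>(t', x')\<close>, lies in the
  corresponding dilate of \<open>K\<close>, and by AM-GM also in their Minkowski combination, which by
  log-concavity of \<open>f\<close> lies in the corresponding superlevel set of \<open>f\<close>. The log-Brunn-Minkowski
  inequality therefore makes \<open>N\<close> log-concave jointly in \<open>(t, x)\<close>. Since \<open>\<mu>(e\<^sup>tK)\<close> is the integral of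
  \<open>e\<^sup>x N t x\<close> over \<open>x\<close>, the one-dimensional Prekopa-Leindler inequality yields the claim; it is
  only needed for integrands whose superlevel sets are intervals, because each
  \<open>x \<mapsto> e\<^sup>x N t x\<close> is itself log-concave.

  The superlevel sets need not be closed. They are replaced by their closures, which have the same
  volume because the frontier of a convex set is negligible.\<close>

section \<open>Log-concavity in multiplicative form, and elementary inequalities\<close>

text \<open>Exponentiating removes the extended reals: as \<open>0 powr s = 0\<close>, a zero value
  of \<open>f\<close> makes the product vanish exactly where the logarithmic form has -\<infinity>
  on the left.\<close>

lemma log_concave_fun_iff:
  fixes f :: "'a::real_vector \<Rightarrow> real"
  shows "log_concave_fun f \<longleftrightarrow> (\<forall>x. 0 \<le> f x) \<and>
    (\<forall>x y. \<forall>s\<in>{0<..<1}. f x powr s * f y powr (1 - s) \<le> f (s *\<^sub>R x + (1 - s) *\<^sub>R y))"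
proof -
  have *: "ereal s * ext_ln a + ereal (1 - s) * ext_ln b \<le> ext_ln c
      \<longleftrightarrow> a powr s * b powr (1 - s) \<le> c"
    if "0 \<le> a" "0 \<le> b" "0 \<le> c" "0 < s" "s < 1" for a b c s :: real
  proof (cases "a = 0 \<or> b = 0")
    case True
    then show ?thesis using that by (auto simp: ext_ln_def)
  next
    case False
    then have ab: "0 < a" "0 < b" using that by auto
    have eq: "a powr s * b powr (1 - s) = exp (s * ln a + (1 - s) * ln b)"
      using ab by (simp add: powr_def exp_add)
    show ?thesis
    proof (cases "c = 0")
      case True
      then show ?thesis using ab by (simp add: ext_ln_def mult_le_0_iff)
    next
      case c: False
      then show ?thesis unfolding eq using ab that
        by (simp add: ext_ln_def ln_ge_iff)
    qed
  qed
  show ?thesis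
    unfolding log_concave_fun_def using * by (smt (verit) greaterThanLessThan_iff)
qed

lemma log_concave_funD:
  assumes "log_concave_fun f" "0 < s" "s < 1"
  shows "f x powr s * f y powr (1 - s) \<le> f (s *\<^sub>R x + (1 - s) *\<^sub>R y)"
  using assms by (simp add: log_concave_fun_iff)

lemma weighted_AM_GM:
  fixes a b s :: real
  assumes "0 \<le> a" "0 \<le> b" "0 < s" "s < 1"
  shows "a powr s * b powr (1 - s) \<le> s * a + (1 - s) * b"
  using Youngs_inequality_0[of s "1 - s" a b] assms by (cases "a = 0 \<or> b = 0") auto

lemma powr_mult_powr_strict_mono:
  fixes a b c d s :: real
  assumes "0 < s" "s < 1" "0 \<le> c" "c < a" "0 \<le> d" "d < b"
  shows "c powr s * d powr (1 - s) < a powr s * b powr (1 - s)"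
  using assms by (intro mult_strict_mono powr_less_mono2) auto

section \<open>Layer-cake formulas\<close>

text \<open>Needed for Fubini over \<open>lebesgue\<close>, because the density is only Lebesgue
  measurable. A cover for \<open>lborel\<close> still works, as completion keeps the measure of
  Borel sets.\<close>

lemma sigma_finite_lebesgue: "sigma_finite_measure (lebesgue :: 'a::euclidean_space measure)"
proof
  obtain A :: "'a set set" where "countable A" "A \<subseteq> sets lborel" "\<Union> A = space lborel"
      "\<forall>a\<in>A. emeasure lborel a \<noteq> \<infinity>"
    using lborel.sigma_finite_countable by auto
  then show "\<exists>A::'a set set. countable A \<and> A \<subseteq> sets lebesgue \<and> \<Union> A = space lebesgue \<and>
      (\<forall>a\<in>A. emeasure lebesgue a \<noteq> \<infinity>)"
    by (intro exI[of _ A]) (auto simp: subset_eq)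
qed

text \<open>Exchange of the two integrals. The parameters \<open>p\<close> and \<open>w\<close>
  serve two parametrizations of the heights: \<open>r\<close> itself with weight 1 on the positive
  half-line, and \<open>exp r\<close> with weight \<open>exp r\<close>.\<close>

lemma nn_integral_superlevel_sets:
  fixes f :: "'a \<Rightarrow> real" and p :: "real \<Rightarrow> real" and w :: "real \<Rightarrow> ennreal"
  assumes "sigma_finite_measure M"
    and [measurable]: "f \<in> borel_measurable M" "p \<in> borel_measurable borel" "w \<in> borel_measurable borel"
  shows "(\<integral>\<^sup>+x. (\<integral>\<^sup>+r. w r * indicator {r. p r < f x} r \<partial>lborel) \<partial>M)
    = (\<integral>\<^sup>+r. w r * emeasure M {x \<in> space M. p r < f x} \<partial>lborel)"
proof -
  interpret M: sigma_finite_measure M by fact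
  interpret P: pair_sigma_finite lborel M ..
  have "(\<integral>\<^sup>+x. (\<integral>\<^sup>+r. w r * indicator {r. p r < f x} r \<partial>lborel) \<partial>M)
      = (\<integral>\<^sup>+r. (\<integral>\<^sup>+x. w r * indicator {r. p r < f x} r \<partial>M) \<partial>lborel)"
    by (rule P.Fubini') (simp add: indicator_def, measurable)
  also have "\<dots> = (\<integral>\<^sup>+r. w r * emeasure M {x \<in> space M. p r < f x} \<partial>lborel)"
  proof (intro nn_integral_cong)
    fix r :: real
    have "(\<integral>\<^sup>+x. w r * indicator {r. p r < f x} r \<partial>M)
        = (\<integral>\<^sup>+x. w r * indicator {x \<in> space M. p r < f x} x \<partial>M)"
      by (intro nn_integral_cong) (auto simp: indicator_def)
    also have "\<dots> = w r * emeasure M {x \<in> space M. p r < f x}"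
      by (rule nn_integral_cmult_indicator) measurable
    finally show "(\<integral>\<^sup>+x. w r * indicator {r. p r < f x} r \<partial>M)
      = w r * emeasure M {x \<in> space M. p r < f x}" .
  qed
  finally show ?thesis .
qed

lemma layer_cake:
  fixes f :: "'a \<Rightarrow> real"
  assumes "sigma_finite_measure M" "f \<in> borel_measurable M" "\<And>x. 0 \<le> f x"
  shows "(\<integral>\<^sup>+x. ennreal (f x) \<partial>M)
    = (\<integral>\<^sup>+r. indicator {0<..} r * emeasure M {x \<in> space M. r < f x} \<partial>lborel)"
proof -
  have "(\<integral>\<^sup>+r. indicator {0<..} r * indicator {r. r < f x} r \<partial>lborel) = ennreal (f x)" for x
  proof -
    have "(\<integral>\<^sup>+r. indicator {0<..} r * indicator {r. r < f x} r \<partial>lborel)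
        = (\<integral>\<^sup>+r. indicator {0<..<f x} r \<partial>lborel)"
      by (intro nn_integral_cong) (auto simp: indicator_def)
    also have "\<dots> = ennreal (f x)" using assms(3)[of x] by simp
    finally show ?thesis .
  qed
  then show ?thesis
    using nn_integral_superlevel_sets[OF assms(1,2), of "\<lambda>r. r" "indicator {0<..}"] by simp
qed

lemma nn_integral_exp_atMost:
  "(\<integral>\<^sup>+r. ennreal (exp r) * indicator {..b} r \<partial>lborel) = ennreal (exp b)" for b :: real
proof -
  have "(\<integral>\<^sup>+r. ennreal (exp r) * indicator {..b} r \<partial>lborel)
      = (\<integral>\<^sup>+r. ennreal (exp (- r)) * indicator {..b} (- r) \<partial>lborel)"
    by (subst nn_integral_real_affine[where c="-1" and t=0]) auto
  also have "\<dots> = (\<integral>\<^sup>+r. ennreal (exp (- r)) * indicator {-b..} r \<partial>lborel)"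
    by (intro nn_integral_cong) (auto simp: indicator_def)
  \<comment> \<open>After the reflection \<open>r \<mapsto> - r\<close> the half-line is unbounded
    above, and the antiderivative \<open>- exp (- r)\<close> tends to 0.\<close>
  also have "\<dots> = ennreal (0 - (- exp (- (- b))))"
  proof (rule nn_integral_FTC_atLeast)
    show "((\<lambda>r::real. - exp (- r)) \<longlongrightarrow> 0) at_top"
      using tendsto_minus[OF filterlim_compose[OF exp_at_bot filterlim_uminus_at_bot_at_top]]
      by simp
  qed (auto intro!: derivative_eq_intros)
  finally show ?thesis by simp
qed

text \<open>With heights written as \<open>exp r\<close>, a geometric mean of heights is an
  arithmetic mean of exponents, which is the form Prekopa-Leindler in \<open>r\<close> asks
  for.\<close>

lemma layer_cake_exp:
  fixes f :: "'a \<Rightarrow> real"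
  assumes "sigma_finite_measure M" "f \<in> borel_measurable M" "\<And>x. 0 \<le> f x"
  shows "(\<integral>\<^sup>+x. ennreal (f x) \<partial>M)
    = (\<integral>\<^sup>+r. ennreal (exp r) * emeasure M {x \<in> space M. exp r < f x} \<partial>lborel)"
proof -
  have "(\<integral>\<^sup>+r. ennreal (exp r) * indicator {r. exp r < f x} r \<partial>lborel) = ennreal (f x)" for x
  proof (cases "f x = 0")
    case True
    then show ?thesis by (simp add: not_less)
  next
    case False
    then have pos: "0 < f x" using assms(3)[of x] by simp
    have "(\<integral>\<^sup>+r. ennreal (exp r) * indicator {r. exp r < f x} r \<partial>lborel)
        = (\<integral>\<^sup>+r. ennreal (exp r) * indicator {..ln (f x)} r \<partial>lborel)"
    proof (rule nn_integral_cong_AE)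
      \<comment> \<open>The two half-lines differ only in this endpoint.\<close>
      have "AE r in lborel. r \<noteq> ln (f x)" by (rule AE_lborel_singleton)
      then show "AE r in lborel. ennreal (exp r) * indicator {r. exp r < f x} r
          = ennreal (exp r) * indicator {..ln (f x)} r"
      proof eventually_elim
        case (elim r)
        have "exp r < f x \<longleftrightarrow> r < ln (f x)" using pos by (metis exp_less_cancel_iff exp_ln)
        then show ?case using elim by (simp add: indicator_def)
      qed
    qed
    also have "\<dots> = ennreal (f x)" using pos by (simp add: nn_integral_exp_atMost)
    finally show ?thesis .
  qed
  then show ?thesis
    using nn_integral_superlevel_sets[OF assms(1,2), of exp "\<lambda>r. ennreal (exp r)"] by simp
qed

section \<open>A one-dimensional Prekopa-Leindler inequality\<close>

lemma greaterThanLessThan_Inf_Sup_subset: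
  fixes A :: "real set"
  assumes "is_interval A" "A \<noteq> {}" "bounded A"
  shows "{Inf A<..<Sup A} \<subseteq> A"
proof
  fix z assume z: "z \<in> {Inf A<..<Sup A}"
  have bd: "bdd_above A" "bdd_below A"
    using assms(3) bounded_imp_bdd_above bounded_imp_bdd_below by auto
  obtain a b where "a \<in> A" "a < z" "b \<in> A" "z < b"
    using z assms(2) bd by (auto simp: cInf_less_iff less_cSup_iff)
  then show "z \<in> A" using assms(1) unfolding is_interval_1 by (meson less_imp_le)
qed

lemma emeasure_le_Sup_minus_Inf:
  fixes A :: "real set"
  assumes "A \<noteq> {}" "bounded A"
  shows "emeasure lborel A \<le> ennreal (Sup A - Inf A)"
proof -
  have bd: "bdd_above A" "bdd_below A"
    using assms(2) bounded_imp_bdd_above bounded_imp_bdd_below by auto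
  have "A \<subseteq> {Inf A..Sup A}" using bd by (auto intro: cInf_lower cSup_upper)
  then have "emeasure lborel A \<le> emeasure lborel {Inf A..Sup A}" by (intro emeasure_mono) auto
  then show ?thesis using cInf_le_cSup[OF assms(1) bd] by simp
qed

text \<open>Infima and suprema need not belong to \<open>A\<close> and \<open>B\<close>, but the
  open interval between their combinations lies in \<open>C\<close>, and its length is the
  combination of the lengths of \<open>A\<close> and \<open>B\<close>.\<close>

lemma interval_Brunn_Minkowski:
  fixes A B C :: "real set"
  assumes A: "is_interval A" "A \<noteq> {}" "bounded A" and B: "is_interval B" "B \<noteq> {}" "bounded B"
    and s: "0 < s" "s < 1" and C: "C \<in> sets borel"
    and sub: "\<And>a b. a \<in> A \<Longrightarrow> b \<in> B \<Longrightarrow> s * a + (1 - s) * b \<in> C"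
  shows "ennreal s * emeasure lborel A + ennreal (1 - s) * emeasure lborel B \<le> emeasure lborel C"
proof -
  let ?a = "Inf A" and ?a' = "Sup A" and ?b = "Inf B" and ?b' = "Sup B"
  have bd: "bdd_above A" "bdd_below A" "bdd_above B" "bdd_below B"
    using A(3) B(3) bounded_imp_bdd_above bounded_imp_bdd_below by auto
  have le: "?a \<le> ?a'" "?b \<le> ?b'" using A B bd by (auto intro: cInf_le_cSup)
  \<comment> \<open>A relative position strictly between 0 and 1 gives a point of \<open>D\<close>
    whether or not \<open>D\<close> contains its endpoints; if \<open>D\<close> is a single point,
    the formula returns it.\<close>
  have pt: "x + \<theta> * (y - x) \<in> D"
    if D: "is_interval D" "D \<noteq> {}" "bounded D" "x = Inf D" "y = Sup D" and \<theta>: "0 < \<theta>" "\<theta> < 1"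
    for x y \<theta> :: real and D
  proof (cases "x < y")
    case True
    then have "0 < \<theta> * (y - x)" "0 < (1 - \<theta>) * (y - x)" using \<theta> by auto
    then have "x + \<theta> * (y - x) \<in> {x<..<y}" by (auto simp: algebra_simps)
    then show ?thesis using greaterThanLessThan_Inf_Sup_subset[OF D(1-3)] D(4,5) by blast
  next
    case False
    obtain d where d: "d \<in> D" using D(2) by auto
    have "x \<le> d" "d \<le> y"
      using D d bounded_imp_bdd_above bounded_imp_bdd_below by (auto intro: cInf_lower cSup_upper)
    then have "x = d" "y = d" using False by auto
    then show ?thesis using d by simp
  qed
  have "{s * ?a + (1 - s) * ?b<..<s * ?a' + (1 - s) * ?b'} \<subseteq> C"
  proof
    fix z assume z: "z \<in> {s * ?a + (1 - s) * ?b<..<s * ?a' + (1 - s) * ?b'}"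
    \<comment> \<open>The points of \<open>A\<close> and \<open>B\<close> at the relative position
      of \<open>z\<close> combine to \<open>z\<close>.\<close>
    define \<theta> where "\<theta> = (z - (s * ?a + (1 - s) * ?b)) /
      (s * ?a' + (1 - s) * ?b' - (s * ?a + (1 - s) * ?b))"
    have \<theta>: "0 < \<theta>" "\<theta> < 1" using z by (auto simp: \<theta>_def)
    have "z = s * ?a + (1 - s) * ?b + \<theta> * (s * ?a' + (1 - s) * ?b' - (s * ?a + (1 - s) * ?b))"
      using z by (simp add: \<theta>_def)
    also have "\<dots> = s * (?a + \<theta> * (?a' - ?a)) + (1 - s) * (?b + \<theta> * (?b' - ?b))"
      by (simp add: algebra_simps)
    also have "\<dots> \<in> C" using \<theta> A B by (intro sub pt) auto
    finally show "z \<in> C" .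
  qed
  then have *: "emeasure lborel {s * ?a + (1 - s) * ?b<..<s * ?a' + (1 - s) * ?b'}
      \<le> emeasure lborel C"
    using C by (intro emeasure_mono) auto
  have "ennreal s * emeasure lborel A + ennreal (1 - s) * emeasure lborel B
      \<le> ennreal s * ennreal (?a' - ?a) + ennreal (1 - s) * ennreal (?b' - ?b)"
    using A B by (intro add_mono mult_left_mono emeasure_le_Sup_minus_Inf) auto
  also have "\<dots> = ennreal (s * (?a' - ?a) + (1 - s) * (?b' - ?b))"
    using s le by (simp add: ennreal_plus ennreal_mult)
  also have "\<dots> = emeasure lborel {s * ?a + (1 - s) * ?b<..<s * ?a' + (1 - s) * ?b'}"
  proof -
    have "s * ?a + (1 - s) * ?b \<le> s * ?a' + (1 - s) * ?b'"
      using s le by (intro add_mono mult_left_mono) auto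
    then show ?thesis by (simp add: algebra_simps)
  qed
  finally show ?thesis using * by simp
qed

text \<open>Both suprema are 1, attained or not, so every height below 1 cuts both functions in
  nonempty sets and Brunn-Minkowski for intervals applies height by height. Integrating over the
  heights yields even the arithmetic mean of the integrals.\<close>

lemma Prekopa_Leindler_normalized:
  fixes \<phi> \<psi> h :: "real \<Rightarrow> real"
  assumes [measurable]: "\<phi> \<in> borel_measurable borel" "\<psi> \<in> borel_measurable borel"
      "h \<in> borel_measurable borel"
    and nn: "\<And>x. 0 \<le> \<phi> x" "\<And>x. 0 \<le> \<psi> x" "\<And>x. 0 \<le> h x"
    and int: "\<And>r. 0 < r \<Longrightarrow> is_interval {x. r < \<phi> x}" "\<And>r. 0 < r \<Longrightarrow> is_interval {x. r < \<psi> x}"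
    and bdd: "\<And>r. 0 < r \<Longrightarrow> bounded {x. r < \<phi> x}" "\<And>r. 0 < r \<Longrightarrow> bounded {x. r < \<psi> x}"
    and le1: "\<And>x. \<phi> x \<le> 1" "\<And>x. \<psi> x \<le> 1"
    and ex: "\<And>r. r < 1 \<Longrightarrow> \<exists>x. r < \<phi> x" "\<And>r. r < 1 \<Longrightarrow> \<exists>x. r < \<psi> x"
    and s: "0 < s" "s < 1"
    and le: "\<And>x y. \<phi> x powr s * \<psi> y powr (1 - s) \<le> h (s * x + (1 - s) * y)"
  shows "ennreal s * (\<integral>\<^sup>+x. \<phi> x \<partial>lborel) + ennreal (1 - s) * (\<integral>\<^sup>+x. \<psi> x \<partial>lborel)
    \<le> (\<integral>\<^sup>+x. h x \<partial>lborel)"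
proof -
  have cake: "(\<integral>\<^sup>+x. ennreal (g x) \<partial>lborel)
      = (\<integral>\<^sup>+r. indicator {0<..} r * emeasure lborel {x. r < g x} \<partial>lborel)"
    if "g \<in> borel_measurable borel" "\<And>x. 0 \<le> g x" for g :: "real \<Rightarrow> real"
    using layer_cake[OF sigma_finite_lborel, of g] that by simp
  have meas: "(\<lambda>r. indicator {0<..} r * emeasure lborel {x. r < g x}) \<in> borel_measurable lborel"
    if [measurable]: "g \<in> borel_measurable borel" for g :: "real \<Rightarrow> real"
    by measurable
  have "ennreal s * (\<integral>\<^sup>+x. \<phi> x \<partial>lborel) + ennreal (1 - s) * (\<integral>\<^sup>+x. \<psi> x \<partial>lborel)
      = (\<integral>\<^sup>+r. ennreal s * (indicator {0<..} r * emeasure lborel {x. r < \<phi> x})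
        + ennreal (1 - s) * (indicator {0<..} r * emeasure lborel {x. r < \<psi> x}) \<partial>lborel)"
    using meas[of \<phi>] meas[of \<psi>] nn by (simp add: cake nn_integral_add nn_integral_cmult)
  also have "\<dots> \<le> (\<integral>\<^sup>+r. indicator {0<..} r * emeasure lborel {x. r < h x} \<partial>lborel)"
  proof (rule nn_integral_mono)
    fix r :: real
    \<comment> \<open>For \<open>r \<le> 0\<close> the indicator annihilates both sides; from height
      1 on, both sets on the left are empty.\<close>
    consider "r \<le> 0" | "0 < r" "r < 1" | "1 \<le> r" by linarith
    then show "ennreal s * (indicator {0<..} r * emeasure lborel {x. r < \<phi> x})
        + ennreal (1 - s) * (indicator {0<..} r * emeasure lborel {x. r < \<psi> x})
        \<le> indicator {0<..} r * emeasure lborel {x. r < h x}"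
    proof cases
      case 2
      have "ennreal s * emeasure lborel {x. r < \<phi> x} + ennreal (1 - s) * emeasure lborel {x. r < \<psi> x}
          \<le> emeasure lborel {x. r < h x}"
      proof (rule interval_Brunn_Minkowski)
        fix a b assume "a \<in> {x. r < \<phi> x}" "b \<in> {x. r < \<psi> x}"
        then have "r powr s * r powr (1 - s) < \<phi> a powr s * \<psi> b powr (1 - s)"
          using 2 s by (intro powr_mult_powr_strict_mono) auto
        then show "s * a + (1 - s) * b \<in> {x. r < h x}"
          using le[of a b] 2 by (simp flip: powr_add)
      qed (use 2 int bdd ex s in auto)
      then show ?thesis using 2 by simp
    next
      case 3
      then have "{x. r < \<phi> x} = {}" "{x. r < \<psi> x} = {}"
        using le1 by (auto simp: not_less intro: order_trans)
      then show ?thesis by simp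
    qed simp
  qed
  also have "\<dots> = (\<integral>\<^sup>+x. h x \<partial>lborel)" using nn by (simp add: cake)
  finally show ?thesis .
qed

text \<open>Dividing by the suprema makes every superlevel set below height 1 nonempty; the
  normalized inequality is then combined with the weighted AM-GM inequality.\<close>

theorem Prekopa_Leindler_unimodal:
  fixes \<phi> \<psi> h :: "real \<Rightarrow> real"
  assumes [measurable]: "\<phi> \<in> borel_measurable borel" "\<psi> \<in> borel_measurable borel"
      "h \<in> borel_measurable borel"
    and nn: "\<And>x. 0 \<le> \<phi> x" "\<And>x. 0 \<le> \<psi> x" "\<And>x. 0 \<le> h x"
    and int: "\<And>r. 0 < r \<Longrightarrow> is_interval {x. r < \<phi> x}" "\<And>r. 0 < r \<Longrightarrow> is_interval {x. r < \<psi> x}"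
    and bdd: "\<And>r. 0 < r \<Longrightarrow> bounded {x. r < \<phi> x}" "\<And>r. 0 < r \<Longrightarrow> bounded {x. r < \<psi> x}"
    and bdd_above: "bdd_above (range \<phi>)" "bdd_above (range \<psi>)"
    and s: "0 < s" "s < 1"
    and le: "\<And>x y. \<phi> x powr s * \<psi> y powr (1 - s) \<le> h (s * x + (1 - s) * y)"
    and I: "(\<integral>\<^sup>+x. \<phi> x \<partial>lborel) = ennreal I1" "(\<integral>\<^sup>+x. \<psi> x \<partial>lborel) = ennreal I2"
      "(\<integral>\<^sup>+x. h x \<partial>lborel) = ennreal J" "0 \<le> I1" "0 \<le> I2" "0 \<le> J"
  shows "I1 powr s * I2 powr (1 - s) \<le> J"
proof (cases "I1 = 0 \<or> I2 = 0")
  case True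
  then show ?thesis using I by auto
next
  case False
  define m n where "m = Sup (range \<phi>)" and "n = Sup (range \<psi>)"
  have upper: "\<phi> x \<le> m" "\<psi> x \<le> n" for x
    using bdd_above by (auto simp: m_def n_def intro: cSup_upper)
  \<comment> \<open>A nonpositive supremum would make the function and hence its integral vanish,
    which the case assumption excludes.\<close>
  have pos: "0 < m" "0 < n"
  proof -
    have "\<not> m \<le> 0"
    proof
      assume "m \<le> 0"
      then have "\<phi> x = 0" for x using upper(1)[of x] nn(1)[of x] by linarith
      then show False using I False by simp
    qed
    moreover have "\<not> n \<le> 0"
    proof
      assume "n \<le> 0"
      then have "\<psi> x = 0" for x using upper(2)[of x] nn(2)[of x] by linarith
      then show False using I False by simp
    qed
    ultimately show "0 < m" "0 < n" by auto
  qed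
  \<comment> \<open>By homogeneity, \<open>le\<close> survives division of \<open>\<phi>\<close> by
    \<open>m\<close> and \<open>\<psi>\<close> by \<open>n\<close> when \<open>h\<close> is divided
    by this \<open>p\<close>.\<close>
  define p where "p = m powr s * n powr (1 - s)"
  have p: "0 < p" using pos by (simp add: p_def)
  have scale: "(\<integral>\<^sup>+x. ennreal (g x / c) \<partial>lborel) = ennreal (a / c)"
    if "g \<in> borel_measurable borel" "\<And>x. 0 \<le> g x" "(\<integral>\<^sup>+x. ennreal (g x) \<partial>lborel) = ennreal a"
      "0 \<le> a" "0 < c" for g :: "real \<Rightarrow> real" and a c :: real
  proof -
    have "(\<integral>\<^sup>+x. ennreal (g x / c) \<partial>lborel) = (\<integral>\<^sup>+x. ennreal (g x) / ennreal c \<partial>lborel)"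
      using that by (simp add: divide_ennreal)
    also have "\<dots> = ennreal a / ennreal c" using that by (simp add: nn_integral_divide)
    finally show ?thesis using that by (simp add: divide_ennreal)
  qed
  have "ennreal s * (\<integral>\<^sup>+x. ennreal (\<phi> x / m) \<partial>lborel) + ennreal (1 - s) * (\<integral>\<^sup>+x. ennreal (\<psi> x / n) \<partial>lborel)
    \<le> (\<integral>\<^sup>+x. ennreal (h x / p) \<partial>lborel)"
  proof (rule Prekopa_Leindler_normalized)
    fix r :: real assume "r < 1"
    then have "r * m < m" "r * n < n" using pos by auto
    then show "\<exists>x. r < \<phi> x / m" "\<exists>x. r < \<psi> x / n"
      using pos bdd_above by (auto simp: m_def n_def less_cSup_iff pos_less_divide_eq)
  next
    fix x y
    have "(\<phi> x / m) powr s * (\<psi> y / n) powr (1 - s) = \<phi> x powr s * \<psi> y powr (1 - s) / p"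
      using pos nn by (simp add: p_def powr_divide)
    also have "\<dots> \<le> h (s * x + (1 - s) * y) / p"
      using p le by (intro divide_right_mono) auto
    finally show "(\<phi> x / m) powr s * (\<psi> y / n) powr (1 - s) \<le> h (s * x + (1 - s) * y) / p" .
  next
    fix r :: real assume "0 < r"
    then have "0 < r * m" "0 < r * n" using pos by auto
    then show "is_interval {x. r < \<phi> x / m}" "is_interval {x. r < \<psi> x / n}"
        "bounded {x. r < \<phi> x / m}" "bounded {x. r < \<psi> x / n}"
      using int bdd pos by (simp_all add: pos_less_divide_eq)
  qed (use pos p s nn upper in auto)
  then have "ennreal s * ennreal (I1 / m) + ennreal (1 - s) * ennreal (I2 / n) \<le> ennreal (J / p)"
    using scale nn I pos p by simp
  then have "ennreal (s * (I1 / m) + (1 - s) * (I2 / n)) \<le> ennreal (J / p)"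
    using s I pos by (simp add: ennreal_mult del: times_divide_eq_right)
  then have *: "s * (I1 / m) + (1 - s) * (I2 / n) \<le> J / p"
    using I p by (simp add: ennreal_le_iff)
  have "I1 powr s * I2 powr (1 - s) = p * ((I1 / m) powr s * (I2 / n) powr (1 - s))"
    using pos I by (simp add: p_def powr_divide)
  also have "\<dots> \<le> p * (s * (I1 / m) + (1 - s) * (I2 / n))"
    using I pos s p by (intro mult_left_mono weighted_AM_GM) auto
  also have "\<dots> \<le> p * (J / p)" using * p by (intro mult_left_mono) auto
  also have "\<dots> = J" using p by simp
  finally show ?thesis .
qed

section \<open>Logarithmic sums of superlevel sets\<close>

lemma support_fun_upper:
  fixes A :: "'a::euclidean_space set"
  assumes "compact A" "y \<in> A"
  shows "u \<bullet> y \<le> support_fun A u"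
proof -
  have "compact ((\<lambda>y. u \<bullet> y) ` A)"
    using assms(1) by (intro compact_continuous_image continuous_intros)
  then have "bdd_above ((\<lambda>y. u \<bullet> y) ` A)"
    by (intro bounded_imp_bdd_above compact_imp_bounded)
  then show ?thesis unfolding support_fun_def using assms(2) by (intro cSUP_upper)
qed

lemma support_fun_attained:
  fixes A :: "'a::euclidean_space set"
  assumes "compact A" "A \<noteq> {}"
  obtains y where "y \<in> A" "support_fun A u = u \<bullet> y"
proof -
  have "continuous_on A (\<lambda>y. u \<bullet> y)" by (intro continuous_intros)
  then obtain y where y: "y \<in> A" "\<forall>z\<in>A. u \<bullet> z \<le> u \<bullet> y"
    using continuous_attains_sup[OF assms] by blast
  then have "support_fun A u = u \<bullet> y"
    unfolding support_fun_def by (intro cSup_eq_maximum) auto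
  then show thesis using y that by blast
qed

text \<open>A point outside would violate the bound for the outward normal of a separating
  hyperplane. Testing unit vectors suffices, which matches the form of
  \<open>log_sum\<close>.\<close>

lemma in_convex_if_le_support_fun:
  fixes A :: "'a::euclidean_space set"
  assumes A: "compact A" "convex A" "A \<noteq> {}"
    and x: "\<And>u. norm u = 1 \<Longrightarrow> x \<bullet> u \<le> support_fun A u"
  shows "x \<in> A"
proof (rule ccontr)
  assume "x \<notin> A"
  then obtain a b where ab: "a \<bullet> x < b" "\<And>y. y \<in> A \<Longrightarrow> b < a \<bullet> y"
    using separating_hyperplane_closed_point[of A x] A compact_imp_closed by blast
  have "a \<noteq> 0" using ab A(3) by fastforce
  \<comment> \<open>\<open>A\<close> lies on the side where the product with \<open>a\<close> is
    larger, so the outward normal points along minus \<open>a\<close>.\<close>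
  define u where "u = - (1 / norm a) *\<^sub>R a"
  have u: "norm u = 1" using \<open>a \<noteq> 0\<close> by (simp add: u_def)
  obtain y where y: "y \<in> A" "support_fun A u = u \<bullet> y"
    using support_fun_attained[OF A(1,3)] .
  have "a \<bullet> x < a \<bullet> y" using ab y by fastforce
  then have "u \<bullet> y < u \<bullet> x" using \<open>a \<noteq> 0\<close> by (simp add: u_def divide_strict_right_mono)
  then show False using x[OF u] y by (simp add: inner_commute)
qed

lemma support_fun_nonneg:
  assumes "compact A" "0 \<in> A"
  shows "0 \<le> support_fun A u"
  using support_fun_upper[OF assms, of u] by simp

text \<open>An intersection of closed half-spaces. This gives the measurability needed to compare
  the volume of a logarithmic sum with that of a superset.\<close>

lemma closed_log_sum: "closed (log_sum s K L)"
proof -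
  have "log_sum s K L = (\<Inter>u\<in>sphere 0 1.
      {x. u \<bullet> x \<le> support_fun K u powr s * support_fun L u powr (1 - s)})"
    by (auto simp: log_sum_def inner_commute)
  then show ?thesis by (simp add: closed_INT closed_halfspace_le)
qed

text \<open>By the AM-GM inequality the geometric mean of the support functions is at most the support
  function of the Minkowski combination.\<close>

lemma log_sum_subset_Minkowski_sum:
  fixes A B :: "'a::euclidean_space set"
  assumes A: "compact A" "convex A" "0 \<in> A" and B: "compact B" "convex B" "0 \<in> B"
    and s: "0 < s" "s < 1"
  shows "log_sum s A B \<subseteq> {s *\<^sub>R a + (1 - s) *\<^sub>R b | a b. a \<in> A \<and> b \<in> B}" (is "_ \<subseteq> ?Q")
proof
  fix x assume x: "x \<in> log_sum s A B"
  have Q: "?Q = {a + b | a b. a \<in> (*\<^sub>R) s ` A \<and> b \<in> (*\<^sub>R) (1 - s) ` B}" by blast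
  show "x \<in> ?Q"
  proof (rule in_convex_if_le_support_fun)
    show cQ: "compact ?Q" unfolding Q using A B by (intro compact_sums compact_scaling)
    have "convex (\<Union>a\<in>(*\<^sub>R) s ` A. \<Union>b\<in>(*\<^sub>R) (1 - s) ` B. {a + b})"
      using A B by (intro convex_sums convex_scaling)
    also have "(\<Union>a\<in>(*\<^sub>R) s ` A. \<Union>b\<in>(*\<^sub>R) (1 - s) ` B. {a + b}) = ?Q" unfolding Q by blast
    finally show "convex ?Q" .
    show "?Q \<noteq> {}" using A B by blast
    fix u :: 'a assume u: "norm u = 1"
    obtain a where a: "a \<in> A" "support_fun A u = u \<bullet> a" using support_fun_attained A by blast
    obtain b where b: "b \<in> B" "support_fun B u = u \<bullet> b" using support_fun_attained B by blast
    have "x \<bullet> u \<le> support_fun A u powr s * support_fun B u powr (1 - s)"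
      using x u by (auto simp: log_sum_def)
    also have "\<dots> \<le> s * support_fun A u + (1 - s) * support_fun B u"
      using A B s by (intro weighted_AM_GM support_fun_nonneg)
    also have "\<dots> = u \<bullet> (s *\<^sub>R a + (1 - s) *\<^sub>R b)" by (simp add: a b inner_add_right)
    also have "\<dots> \<le> support_fun ?Q u" using a b by (intro support_fun_upper cQ) blast
    finally show "x \<bullet> u \<le> support_fun ?Q u" .
  qed
qed

text \<open>The support functions of \<open>A\<close> and \<open>B\<close> are at most
  \<open>exp t\<close> and \<open>exp t'\<close> times that of \<open>K\<close>, and the geometric
  mean of these factors is the exponential of the averaged parameters. A Minkowski combination would
  only give the larger factor \<open>s * exp t + (1 - s) * exp t'\<close>.\<close>

lemma log_sum_subset_scaling:
  fixes A B K :: "'a::euclidean_space set"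
  assumes K: "compact K" "convex K"
    and A: "compact A" "0 \<in> A" "A \<subseteq> (*\<^sub>R) (exp t) ` K"
    and B: "compact B" "0 \<in> B" "B \<subseteq> (*\<^sub>R) (exp t') ` K"
    and s: "0 < s" "s < 1"
  shows "log_sum s A B \<subseteq> (*\<^sub>R) (exp (s * t + (1 - s) * t')) ` K" (is "_ \<subseteq> ?M")
proof
  fix x assume x: "x \<in> log_sum s A B"
  have K0: "0 \<in> K" using A by auto
  show "x \<in> ?M"
  proof (rule in_convex_if_le_support_fun)
    show cM: "compact ?M" "convex ?M" using K by (auto intro: compact_scaling convex_scaling)
    show "?M \<noteq> {}" using K0 by blast
    fix u :: 'a assume u: "norm u = 1"
    have le: "support_fun D u \<le> exp r * support_fun K u"
      if cD: "compact D" and D0: "0 \<in> D" and D: "D \<subseteq> (*\<^sub>R) (exp r) ` K" for D r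
    proof -
      have "D \<noteq> {}" using D0 by blast
      then obtain d where d: "d \<in> D" "support_fun D u = u \<bullet> d"
        using support_fun_attained[OF cD] by metis
      then obtain k where "k \<in> K" "d = exp r *\<^sub>R k" using D by blast
      then show ?thesis using d support_fun_upper[OF K(1), of k u] by simp
    qed
    have nnK: "0 \<le> support_fun K u" by (rule support_fun_nonneg[OF K(1) K0])
    obtain k where k: "k \<in> K" "support_fun K u = u \<bullet> k" using support_fun_attained K K0 by blast
    have "x \<bullet> u \<le> support_fun A u powr s * support_fun B u powr (1 - s)"
      using x u by (auto simp: log_sum_def)
    also have "\<dots> \<le> (exp t * support_fun K u) powr s * (exp t' * support_fun K u) powr (1 - s)"
      using A B s by (intro mult_mono powr_mono2 le support_fun_nonneg) auto
    also have "\<dots> = exp (s * t + (1 - s) * t') * (support_fun K u powr s * support_fun K u powr (1 - s))"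
    proof -
      have "exp t powr s * exp t' powr (1 - s) = exp (s * t + (1 - s) * t')"
        by (simp add: exp_powr_real exp_add mult_ac)
      then show ?thesis using nnK by (simp add: powr_mult mult_ac)
    qed
    also have "\<dots> = exp (s * t + (1 - s) * t') * support_fun K u"
      using nnK by (simp flip: powr_add)
    also have "\<dots> = u \<bullet> (exp (s * t + (1 - s) * t') *\<^sub>R k)" by (simp add: k)
    also have "\<dots> \<le> support_fun ?M u" using k by (intro support_fun_upper cM) blast
    finally show "x \<bullet> u \<le> support_fun ?M u" .
  qed
qed

lemma zero_in_symmetric_convex:
  fixes A :: "'a::real_vector set"
  assumes "convex A" "A \<noteq> {}" "\<And>x. x \<in> A \<Longrightarrow> - x \<in> A"
  shows "0 \<in> A"
proof -
  obtain x where "x \<in> A" using assms(2) by blast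
  then have "(1/2) *\<^sub>R x + (1/2) *\<^sub>R (- x) \<in> A" using assms by (intro convexD) auto
  then show ?thesis by simp
qed

section \<open>Superlevel sets of the density, intersected with dilates of the body\<close>

lemma superlevel_log_concave:
  assumes "log_concave_fun f" "0 < s" "s < 1" "exp x < f y" "exp x' < f y'"
  shows "exp (s * x + (1 - s) * x') < f (s *\<^sub>R y + (1 - s) *\<^sub>R y')"
proof -
  have "exp (s * x + (1 - s) * x') = exp x powr s * exp x' powr (1 - s)"
    by (simp add: exp_powr_real exp_add mult_ac)
  also have "\<dots> < f y powr s * f y' powr (1 - s)"
    using assms by (intro powr_mult_powr_strict_mono) auto
  also have "\<dots> \<le> f (s *\<^sub>R y + (1 - s) *\<^sub>R y')" using assms by (intro log_concave_funD)
  finally show ?thesis .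
qed

lemma convex_superlevel:
  assumes "log_concave_fun f"
  shows "convex {y. exp x < f y}"
proof (rule convexI)
  fix y z :: 'a and u v :: real
  assume *: "y \<in> {y. exp x < f y}" "z \<in> {y. exp x < f y}" "0 \<le> u" "0 \<le> v" "u + v = 1"
  then have v: "v = 1 - u" by simp
  consider "u = 0" | "u = 1" | "0 < u" "u < 1" using * by linarith
  then show "u *\<^sub>R y + v *\<^sub>R z \<in> {y. exp x < f y}"
  proof cases
    case 3
    then show ?thesis using superlevel_log_concave[OF assms, of u x y x z] * v
      by (simp flip: distrib_right)
  qed (use * v in auto)
qed

text \<open>The volume of this set is the quantity \<open>N t x\<close> of the opening
  comment.\<close>

definition dilate_superlevel :: "('a::euclidean_space \<Rightarrow> real) \<Rightarrow> 'a set \<Rightarrow> real \<Rightarrow> real \<Rightarrow> 'a set" where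
  "dilate_superlevel f K t x = (*\<^sub>R) (exp t) ` K \<inter> {y. exp x < f y}"

context
  fixes f :: "'a::euclidean_space \<Rightarrow> real" and K :: "'a set"
  assumes f: "log_concave_fun f" "\<And>x. f (- x) = f x" and K: "symmetric_convex_body K"
begin

lemma compact_convex_dilate: "compact ((*\<^sub>R) (exp t) ` K)" "convex ((*\<^sub>R) (exp t) ` K)"
  using K by (auto simp: symmetric_convex_body_def convex_body_def compact_scaling convex_scaling)

lemma convex_dilate_superlevel: "convex (dilate_superlevel f K t x)"
  unfolding dilate_superlevel_def
  by (intro convex_Int compact_convex_dilate convex_superlevel f)

lemma bounded_dilate_superlevel: "bounded (dilate_superlevel f K t x)"
  unfolding dilate_superlevel_def
  using compact_convex_dilate(1) compact_imp_bounded by (blast intro: bounded_Int)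

lemma lmeasurable_dilate_superlevel: "dilate_superlevel f K t x \<in> lmeasurable"
  by (intro measurable_convex convex_dilate_superlevel bounded_dilate_superlevel)

lemma dilate_superlevel_uminus:
  assumes "y \<in> dilate_superlevel f K t x"
  shows "- y \<in> dilate_superlevel f K t x"
proof -
  obtain k where k: "k \<in> K" "y = exp t *\<^sub>R k" "exp x < f y"
    using assms by (auto simp: dilate_superlevel_def)
  have "- k \<in> K" using k K unfolding symmetric_convex_body_def by blast
  then have "- y \<in> (*\<^sub>R) (exp t) ` K" using k by (intro image_eqI[of _ _ "- k"]) auto
  then show ?thesis using k f(2) by (simp add: dilate_superlevel_def)
qed

text \<open>A convex set with empty interior lies in its own frontier and is negligible, so positive
  volume forces an interior point. This makes the closure a body to which the log-Brunn-Minkowski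
  inequality applies.\<close>

lemma closure_dilate_superlevel:
  assumes "0 < measure lebesgue (dilate_superlevel f K t x)"
  shows "symmetric_convex_body (closure (dilate_superlevel f K t x))"
    and "measure lebesgue (closure (dilate_superlevel f K t x))
      = measure lebesgue (dilate_superlevel f K t x)"
    and "0 \<in> closure (dilate_superlevel f K t x)"
    and "closure (dilate_superlevel f K t x) \<subseteq> (*\<^sub>R) (exp t) ` K"
proof -
  let ?S = "dilate_superlevel f K t x"
  have ne: "interior ?S \<noteq> {}"
  proof
    assume "interior ?S = {}"
    then have "?S \<subseteq> frontier ?S" by (simp add: frontier_def closure_subset)
    then have "negligible ?S"
      using negligible_convex_frontier[OF convex_dilate_superlevel] negligible_subset by blast
    then show False using assms by (simp add: negligible_imp_measure0)
  qed
  have "- y \<in> closure ?S" if "y \<in> closure ?S" for y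
  proof -
    have "- y \<in> uminus ` closure ?S" using that by simp
    also have "\<dots> = closure (uminus ` ?S)"
      using closure_injective_linear_image[of uminus ?S]
      by (simp add: linear_uminus inj_on_def)
    also have "\<dots> \<subseteq> closure ?S" by (intro closure_mono) (auto intro: dilate_superlevel_uminus)
    finally show ?thesis .
  qed
  then have sym: "closure ?S = uminus ` closure ?S" by force
  have "interior (closure ?S) \<noteq> {}" using ne interior_mono[OF closure_subset] by blast
  then show "symmetric_convex_body (closure ?S)"
    using sym bounded_dilate_superlevel convex_dilate_superlevel
    unfolding symmetric_convex_body_def convex_body_def by (auto intro: convex_closure)
  have "closure ?S = ?S \<union> frontier ?S"
    using closure_subset interior_subset by (fastforce simp: frontier_def)
  then show "measure lebesgue (closure ?S) = measure lebesgue ?S"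
    using negligible_convex_frontier[OF convex_dilate_superlevel] lmeasurable_dilate_superlevel
    by (simp add: measure_Un_null_set negligible_iff_null_sets fmeasurableD)
  have "0 \<in> ?S"
    using ne interior_subset convex_dilate_superlevel dilate_superlevel_uminus
    by (intro zero_in_symmetric_convex) auto
  then show "0 \<in> closure ?S" using closure_subset by blast
  show "closure ?S \<subseteq> (*\<^sub>R) (exp t) ` K"
    using compact_convex_dilate(1) compact_imp_closed
    by (intro closure_minimal) (auto simp: dilate_superlevel_def)
qed

text \<open>The bound by the dilate comes from the support functions, the other one from the
  Minkowski combination. The latter reaches only the closure of the superlevel set, since
  \<open>f\<close> need not be upper semicontinuous.\<close>

lemma log_sum_closure_dilate_superlevel:
  assumes pos: "0 < measure lebesgue (dilate_superlevel f K t x)"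
      "0 < measure lebesgue (dilate_superlevel f K t' x')"
    and s: "0 < s" "s < 1"
  shows "log_sum s (closure (dilate_superlevel f K t x)) (closure (dilate_superlevel f K t' x'))
    \<subseteq> (*\<^sub>R) (exp (s * t + (1 - s) * t')) ` K \<inter> closure {y. exp (s * x + (1 - s) * x') < f y}"
    (is "log_sum s (closure ?A) (closure ?B) \<subseteq> ?M \<inter> closure ?C")
proof -
  note A = closure_dilate_superlevel[OF pos(1)] and B = closure_dilate_superlevel[OF pos(2)]
  have cc: "compact (closure ?A)" "convex (closure ?A)" "compact (closure ?B)" "convex (closure ?B)"
    using A(1) B(1) by (auto simp: symmetric_convex_body_def convex_body_def)
  have "log_sum s (closure ?A) (closure ?B) \<subseteq> ?M"
    using K A B cc s
    by (intro log_sum_subset_scaling) (auto simp: symmetric_convex_body_def convex_body_def)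
  moreover have "log_sum s (closure ?A) (closure ?B) \<subseteq> closure ?C"
  proof
    fix z assume "z \<in> log_sum s (closure ?A) (closure ?B)"
    then obtain a b where ab: "a \<in> closure ?A" "b \<in> closure ?B" "z = s *\<^sub>R a + (1 - s) *\<^sub>R b"
      using log_sum_subset_Minkowski_sum[OF cc(1,2) A(3) cc(3,4) B(3) s] by blast
    \<comment> \<open>The strict height bounds may fail at \<open>a\<close> and \<open>b\<close>, so
      log-concavity is applied along approximating sequences and the limit is taken
      afterwards.\<close>
    obtain p q where p: "\<And>n::nat. p n \<in> ?A" "p \<longlonglongrightarrow> a" and q: "\<And>n::nat. q n \<in> ?B" "q \<longlonglongrightarrow> b"
      using ab by (auto simp: closure_sequential)
    have "s *\<^sub>R p n + (1 - s) *\<^sub>R q n \<in> ?C" for n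
      using superlevel_log_concave[OF f(1) s, of x "p n" x' "q n"] p(1)[of n] q(1)[of n]
      by (simp add: dilate_superlevel_def)
    moreover have "(\<lambda>n. s *\<^sub>R p n + (1 - s) *\<^sub>R q n) \<longlonglongrightarrow> z"
      unfolding ab(3) using p q by (intro tendsto_intros)
    ultimately show "z \<in> closure ?C" 
      unfolding closure_sequential
      by (intro exI[of _ "\<lambda>n. s *\<^sub>R p n + (1 - s) *\<^sub>R q n"]) auto
  qed
  ultimately show ?thesis by blast
qed

text \<open>If one volume is 0, the left side is 0. Otherwise the log-Brunn-Minkowski inequality for
  the closures is combined with the inclusion of their logarithmic sum.\<close>

lemma measure_dilate_superlevel_log_concave:
  assumes log_BM: "\<And>(K :: 'a set) L s.
      symmetric_convex_body K \<Longrightarrow> symmetric_convex_body L \<Longrightarrow> 0 < s \<Longrightarrow> s < 1 \<Longrightarrow>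
      measure lebesgue (log_sum s K L)
        \<ge> measure lebesgue K powr s * measure lebesgue L powr (1 - s)"
    and s: "0 < s" "s < 1"
  shows "measure lebesgue (dilate_superlevel f K t x) powr s
      * measure lebesgue (dilate_superlevel f K t' x') powr (1 - s)
    \<le> measure lebesgue (dilate_superlevel f K (s * t + (1 - s) * t') (s * x + (1 - s) * x'))"
    (is "measure _ ?A powr _ * measure _ ?B powr _ \<le> measure _ ?S")
proof (cases "measure lebesgue ?A = 0 \<or> measure lebesgue ?B = 0")
  case False
  then have pos: "0 < measure lebesgue ?A" "0 < measure lebesgue ?B"
    by (auto simp: zero_less_measure_iff)
  note A = closure_dilate_superlevel[OF pos(1)] and B = closure_dilate_superlevel[OF pos(2)]
  let ?M = "(*\<^sub>R) (exp (s * t + (1 - s) * t')) ` K" and ?C = "{y. exp (s * x + (1 - s) * x') < f y}"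
  have MC: "?M \<inter> closure ?C \<in> lmeasurable"
    using compact_convex_dilate(1) by (intro lmeasurable_compact compact_Int_closed) auto
  have null: "frontier ?C \<in> null_sets lebesgue"
    using negligible_convex_frontier[OF convex_superlevel[OF f(1)]]
    by (simp add: negligible_iff_null_sets)
  have "measure lebesgue ?A powr s * measure lebesgue ?B powr (1 - s)
      \<le> measure lebesgue (log_sum s (closure ?A) (closure ?B))"
    using log_BM[OF A(1) B(1) s] A(2) B(2) by simp
  also have "\<dots> \<le> measure lebesgue (?M \<inter> closure ?C)"
    using log_sum_closure_dilate_superlevel[OF pos s] MC
    by (intro measure_mono_fmeasurable sets_completionI_sets) (auto simp: borel_closed closed_log_sum)
  \<comment> \<open>Passing from the closure of \<open>?C\<close> back to \<open>?C\<close> costs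
    only the frontier, which is null because \<open>?C\<close> is convex.\<close>
  also have "\<dots> \<le> measure lebesgue (?S \<union> frontier ?C)"
    using MC null lmeasurable_dilate_superlevel interior_subset
    by (intro measure_mono_fmeasurable fmeasurable.Un)
      (auto simp: dilate_superlevel_def frontier_def fmeasurableD fmeasurableI_null_sets)
  also have "\<dots> = measure lebesgue ?S"
    using null lmeasurable_dilate_superlevel by (simp add: measure_Un_null_set fmeasurableD)
  finally show ?thesis .
qed auto

section \<open>The measure of a dilate as an integral over heights\<close>

text \<open>\<open>layer_cake_exp\<close> is applied to \<open>f\<close> times the indicator of the
  dilate. As \<open>exp x\<close> is positive, points outside the dilate never exceed this height,
  so the superlevel sets are the sets \<open>dilate_superlevel f K t x\<close>.\<close>

lemma emeasure_density_dilate: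
  assumes [measurable]: "f \<in> borel_measurable lebesgue"
  shows "emeasure (density lebesgue (\<lambda>x. ennreal (f x))) ((*\<^sub>R) (exp t) ` K)
    = (\<integral>\<^sup>+x. ennreal (exp x * measure lebesgue (dilate_superlevel f K t x)) \<partial>lborel)"
proof -
  let ?M = "(*\<^sub>R) (exp t) ` K"
  have [measurable]: "?M \<in> sets lebesgue"
    using compact_convex_dilate(1) lmeasurable_compact by blast
  have nn: "0 \<le> f y" for y using f(1) by (simp add: log_concave_fun_def)
  have "emeasure (density lebesgue (\<lambda>x. ennreal (f x))) ?M
      = (\<integral>\<^sup>+y. ennreal (f y * indicator ?M y) \<partial>lebesgue)"
    by (subst emeasure_density) (auto intro!: nn_integral_cong simp: indicator_def)
  also have "\<dots> = (\<integral>\<^sup>+x. ennreal (exp x)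
      * emeasure lebesgue {y \<in> space lebesgue. exp x < f y * indicator ?M y} \<partial>lborel)"
    using nn by (intro layer_cake_exp sigma_finite_lebesgue) auto
  also have "\<dots> = (\<integral>\<^sup>+x. ennreal (exp x * measure lebesgue (dilate_superlevel f K t x)) \<partial>lborel)"
  proof (rule nn_integral_cong)
    fix x :: real
    have "{y \<in> space lebesgue. exp x < f y * indicator ?M y} = dilate_superlevel f K t x"
      using exp_gt_zero[of x] by (auto simp: dilate_superlevel_def indicator_def split: if_splits)
    moreover have "emeasure lebesgue (dilate_superlevel f K t x)
        = ennreal (measure lebesgue (dilate_superlevel f K t x))"
      using lmeasurable_dilate_superlevel by (simp add: emeasure_eq_measure2 fmeasurableD2)
    ultimately show "ennreal (exp x) * emeasure lebesgue {y \<in> space lebesgue. exp x < f y * indicator ?M y}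
        = ennreal (exp x * measure lebesgue (dilate_superlevel f K t x))"
      by (simp add: ennreal_mult)
  qed
  finally show ?thesis .
qed

text \<open>The volume decreases in \<open>x\<close>, so its negative is monotone and hence Borel
  measurable.\<close>

lemma borel_measurable_dilate_superlevel:
  "(\<lambda>x. exp x * measure lebesgue (dilate_superlevel f K t x)) \<in> borel_measurable borel"
proof -
  have "mono (\<lambda>x. - measure lebesgue (dilate_superlevel f K t x))"
    using lmeasurable_dilate_superlevel
    by (intro monoI) (auto simp: dilate_superlevel_def fmeasurableD
      intro!: measure_mono_fmeasurable elim: order.strict_trans1[rotated])
  then have "(\<lambda>x. - measure lebesgue (dilate_superlevel f K t x)) \<in> borel_measurable borel"
    by (rule borel_measurable_mono)
  then have [measurable]: "(\<lambda>x. measure lebesgue (dilate_superlevel f K t x)) \<in> borel_measurable borel"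
    by simp
  show ?thesis by measurable
qed

lemma measure_dilate_superlevel_le:
  "measure lebesgue (dilate_superlevel f K t x) \<le> measure lebesgue ((*\<^sub>R) (exp t) ` K)"
  using lmeasurable_dilate_superlevel compact_convex_dilate(1)
  by (intro measure_mono_fmeasurable)
    (auto simp: dilate_superlevel_def fmeasurableD intro: lmeasurable_compact)

lemma exp_less_if_dilate_superlevel_pos:
  assumes "0 < measure lebesgue (dilate_superlevel f K t x)"
  shows "exp x < f 0"
proof -
  have "dilate_superlevel f K t x \<noteq> {}" using assms by auto
  then obtain y where "exp x < f y" by (auto simp: dilate_superlevel_def)
  then show ?thesis using even_log_concave_le_zero[OF f, of y] by simp
qed

text \<open>Heights from \<open>f 0\<close> on contribute nothing, because \<open>f\<close> is
  largest at 0; below, the volume is at most that of the dilate.\<close>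

lemma bdd_above_exp_measure_dilate_superlevel:
  "bdd_above (range (\<lambda>x. exp x * measure lebesgue (dilate_superlevel f K t x)))"
proof (rule bdd_aboveI2)
  fix x
  show "exp x * measure lebesgue (dilate_superlevel f K t x)
      \<le> f 0 * measure lebesgue ((*\<^sub>R) (exp t) ` K)"
  proof (cases "measure lebesgue (dilate_superlevel f K t x) = 0")
    case True
    have "0 \<le> f 0" using f(1) by (simp add: log_concave_fun_def)
    then show ?thesis using True by simp
  next
    case False
    then have "exp x < f 0"
      using exp_less_if_dilate_superlevel_pos by (simp add: zero_less_measure_iff)
    moreover from this have "0 \<le> f 0" using exp_gt_zero[of x] by linarith
    ultimately show ?thesis using measure_dilate_superlevel_le by (intro mult_mono) auto
  qed
qed

text \<open>The maximum \<open>f 0\<close> bounds \<open>x\<close> from above. From below,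
  \<open>exp x\<close> times the volume of the dilate must exceed \<open>r\<close>.\<close>

lemma bounded_superlevel_exp_measure_dilate_superlevel:
  assumes "0 < r"
  shows "bounded {x. r < exp x * measure lebesgue (dilate_superlevel f K t x)}"
proof (rule bounded_subset)
  let ?V = "measure lebesgue ((*\<^sub>R) (exp t) ` K)"
  show "bounded {ln (r / ?V)..ln (f 0)}" by simp
  show "{x. r < exp x * measure lebesgue (dilate_superlevel f K t x)} \<subseteq> {ln (r / ?V)..ln (f 0)}"
  proof clarify
    fix x assume r: "r < exp x * measure lebesgue (dilate_superlevel f K t x)"
    then have pos: "0 < measure lebesgue (dilate_superlevel f K t x)"
      using assms by (metis less_trans zero_less_mult_pos exp_gt_zero)
    have "exp x < f 0" by (rule exp_less_if_dilate_superlevel_pos[OF pos])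
    then have "x \<le> ln (f 0)" using exp_gt_zero[of x] by (subst ln_ge_iff) linarith+
    moreover have V: "0 < ?V" using pos measure_dilate_superlevel_le[of t x] by linarith
    moreover have "r < exp x * ?V"
      using r mult_left_mono[OF measure_dilate_superlevel_le[of t x] exp_ge_zero[of x]] by linarith
    then have "r / ?V < exp x" using V by (simp add: pos_divide_less_eq)
    then have "ln (r / ?V) \<le> x" using V assms by (metis divide_pos_pos less_imp_le ln_exp ln_mono)
    ultimately show "x \<in> {ln (r / ?V)..ln (f 0)}" by simp
  qed
qed

end

section \<open>Prekopa-Leindler applied to the height integrals of the dilates\<close>

theorem corollary3p2:
  fixes \<mu> :: "(real ^ 'n) measure" and K :: "(real ^ 'n) set"
  assumes log_BM: "\<And>(K :: (real ^ 'n) set) L s.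
      symmetric_convex_body K \<Longrightarrow> symmetric_convex_body L \<Longrightarrow> 0 < s \<Longrightarrow> s < 1 \<Longrightarrow>
      measure lebesgue (log_sum s K L)
        \<ge> measure lebesgue K powr s * measure lebesgue L powr (1 - s)"
    and "has_even_log_concave_density \<mu>"
    and "symmetric_convex_body K"
  shows "log_concave_fun (\<lambda>t::real. measure \<mu> ((\<lambda>x. exp t *\<^sub>R x) ` K))"
proof -
  obtain f where f: "f \<in> borel_measurable lebesgue" "log_concave_fun f" "\<And>x. f (- x) = f x"
    and \<mu>: "\<mu> = density lebesgue (\<lambda>x. ennreal (f x))"
    using assms(2) unfolding has_even_log_concave_density_def by blast
  note fK = f(2,3) assms(3)
  define \<phi> where "\<phi> t x = exp x * measure lebesgue (dilate_superlevel f K t x)" for t x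
  \<comment> \<open>The weight \<open>exp x\<close> has a linear logarithm, so it contributes with
    equality and joint log-concavity passes from the volumes to \<open>\<phi>\<close>.\<close>
  have \<phi>_le: "\<phi> t x powr s * \<phi> t' x' powr (1 - s) \<le> \<phi> (s * t + (1 - s) * t') (s * x + (1 - s) * x')"
    if s: "0 < s" "s < 1" for s t t' x x'
  proof -
    let ?N = "\<lambda>t x. measure lebesgue (dilate_superlevel f K t x)"
    have "\<phi> t x powr s * \<phi> t' x' powr (1 - s)
        = exp (s * x + (1 - s) * x') * (?N t x powr s * ?N t' x' powr (1 - s))"
      by (simp add: \<phi>_def powr_mult exp_powr_real exp_add mult_ac)
    also have "\<dots> \<le> \<phi> (s * t + (1 - s) * t') (s * x + (1 - s) * x')"
      unfolding \<phi>_def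
      using measure_dilate_superlevel_log_concave[OF fK log_BM s] by (intro mult_left_mono) auto
    finally show ?thesis .
  qed
  have interval: "is_interval {x. r < \<phi> t x}" if "0 < r" for r t
  proof -
    \<comment> \<open>Equal dilation parameters in \<open>\<phi>_le\<close> leave \<open>t\<close>
      fixed.\<close>
    have "log_concave_fun (\<phi> t)"
      unfolding log_concave_fun_iff
    proof (intro conjI allI ballI)
      fix x y s :: real assume "s \<in> {0<..<1}"
      moreover have "s * t + (1 - s) * t = t" by (simp add: algebra_simps)
      ultimately show "\<phi> t x powr s * \<phi> t y powr (1 - s) \<le> \<phi> t (s *\<^sub>R x + (1 - s) *\<^sub>R y)"
        using \<phi>_le[of s t x t y] by simp
    qed (simp add: \<phi>_def)
    from convex_superlevel[OF this, of "ln r"] show ?thesis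
      using that by (simp add: is_interval_convex_1)
  qed
  have int: "(\<integral>\<^sup>+x. ennreal (\<phi> t x) \<partial>lborel) = ennreal (measure \<mu> ((*\<^sub>R) (exp t) ` K))" for t
  proof -
    \<comment> \<open>Finiteness matters, since \<open>measure\<close> would be 0 on a set of
      infinite measure.\<close>
    have "emeasure \<mu> ((*\<^sub>R) (exp t) ` K) < \<infinity>"
      using assms(2) compact_convex_dilate(1)[OF fK]
      by (rule emeasure_even_log_concave_density_finite)
    then have "emeasure \<mu> ((*\<^sub>R) (exp t) ` K) = ennreal (measure \<mu> ((*\<^sub>R) (exp t) ` K))"
      by (intro emeasure_eq_ennreal_measure) auto
    then show ?thesis
      using emeasure_density_dilate[OF fK f(1), of t] by (simp add: \<phi>_def \<mu>)
  qed
  show ?thesis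
    unfolding log_concave_fun_iff
  proof (intro conjI allI ballI)
    fix t t' s :: real assume s: "s \<in> {0<..<1}"
    show "measure \<mu> ((*\<^sub>R) (exp t) ` K) powr s * measure \<mu> ((*\<^sub>R) (exp t') ` K) powr (1 - s)
        \<le> measure \<mu> ((*\<^sub>R) (exp (s *\<^sub>R t + (1 - s) *\<^sub>R t')) ` K)"
    \<comment> \<open>The three functions are \<open>\<phi>\<close> at \<open>t\<close>, at
      \<open>t'\<close> and at their combination; by \<open>int\<close> their integrals are the
      three measures.\<close>
    proof (rule Prekopa_Leindler_unimodal)
      show "\<phi> t x powr s * \<phi> t' y powr (1 - s)
          \<le> \<phi> (s *\<^sub>R t + (1 - s) *\<^sub>R t') (s * x + (1 - s) * y)" for x y
        using \<phi>_le s by simp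
      show "bounded {x. r < \<phi> t x}" if "0 < r" for r t
        using bounded_superlevel_exp_measure_dilate_superlevel[OF fK that] by (simp add: \<phi>_def)
      then show "bounded {x. r < \<phi> t' x}" if "0 < r" for r using that .
      show "bdd_above (range (\<phi> t))" "bdd_above (range (\<phi> t'))"
        using bdd_above_exp_measure_dilate_superlevel[OF fK] by (simp_all add: \<phi>_def[abs_def])
      show "\<phi> t \<in> borel_measurable borel" "\<phi> t' \<in> borel_measurable borel"
          "\<phi> (s *\<^sub>R t + (1 - s) *\<^sub>R t') \<in> borel_measurable borel"
        using borel_measurable_dilate_superlevel[OF fK] by (simp_all add: \<phi>_def[abs_def])
    qed (use s int interval in \<open>auto simp: \<phi>_def\<close>)
  qed simp
qed

end
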